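(* Let $d\ge 1$, $\nu>0$ and $\alpha=1-\frac{2}{\nu+d}$ (so that $\alpha$ ranges over $((d-2)/d,1)$ as $\nu$ ranges over $(0,\infty)$). The $d$-dimensional Student distributions with fixed degrees of freedom $\nu$, $\{p_\theta\}$, parametrized by $\theta=[\mu_i,\sigma_{ij}]^\top_{i,j\in\{1,\dots,d\},\,i\le j}$, form a regular $\mathbb{M}^{(\alpha)}$-family.
   Context: Student distributions: for $\boldsymbol{\mu}=[\mu_1,\dots,\mu_d]^\top\in\mathbb{R}^d$, $\boldsymbol{\Sigma}=(\sigma_{ij})$ a symmetric positive-definite $d\times d$ matrix and $\nu>0$, the $d$-dimensional Student distribution is the density on $\mathbb{R}^d$ $$p_\theta(\mathbf{x})=N_{\theta,\alpha}\big[1+b_\alpha(\mathbf{x}-\boldsymbol{\mu})^\top\boldsymbol{\Sigma}^{-1}(\mathbf{x}-\boldsymbol{\mu})\big]^{\frac{1}{\alpha-1}},$$ where $\alpha=1-\frac{2}{\nu+d}$, $b_\alpha=\frac1\nu=\frac{1-\alpha}{2-d(1-\alpha)}$, and $N_{\theta,\alpha}=\frac{\Gamma((\nu+d)/2)}{\Gamma(\nu/2)(\nu\pi)^{d/2}|\boldsymbol{\Sigma}|^{1/2}}$. Here $\theta=[\mu_i,\sigma_{ij}]^\top_{i\le j}$ ranges over the open set $\Theta\subset\mathbb{R}^{d(d+3)/2}$ for which $\boldsymbol{\Sigma}$ is positive definite. $\mathbb{M}^{(\alpha)}$-family ($\alpha\neq1$): a family of probability distributions $\{p_\theta:\theta\in\Theta\}$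 on $\mathbb{R}^d$, $\Theta\subset\mathbb{R}^k$ open, with $\mathbb{S}$ the support of $p_\theta$, is a $k$-parameter $\mathbb{M}^{(\alpha)}$-family characterized by $h,w,f,\Theta,\mathbb{S}$ if there are $w=[w_1,\dots,w_s]^\top$ with each $w_i:\Theta\to\mathbb{R}$ differentiable, $f=[f_1,\dots,f_s]^\top$ with $f_i:\mathbb{R}^d\to\mathbb{R}$, $h:\mathbb{R}^d\to\mathbb{R}$, and a differentiable $Z:\Theta\to\mathbb{R}$ (the normalizing factor) with $$p_\theta(\mathbf{x})=Z(\theta)[h(\mathbf{x})+w(\theta)^\top f(\mathbf{x})]^{\frac1{\alpha-1}}\ \text{ for }\mathbf{x}\in\mathbb{S},\qquad p_\theta(\mathbf{x})=0\ \text{ otherwise}.$$ It is regular if (i) $\mathbb{S}$ does not depend on $\theta$; (ii) $s=k$; (iii) $1,w_1,\dots,w_s$ are linearly independent functions on $\Theta$; (iv) $f_1,\dots,f_s$ are linearly independent functions on $\mathbb{S}$. *)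

theory Defs
  imports "HOL-Probability.Probability" "HOL-Library.Uprod"
begin

section \<open>Families of probability densities\<close>

definition prob_density :: "(real^'d \<Rightarrow> real) \<Rightarrow> bool" where
  "prob_density q \<longleftrightarrow>
     q \<in> borel_measurable borel \<and> (\<forall>x. 0 \<le> q x) \<and>
     prob_space (density lborel (\<lambda>x. ennreal (q x)))"

text \<open>Independence of an indexed family (not of its set of values) of real functions,
  restricted to the set \<open>A\<close>.\<close>

definition lin_indep_funs_on :: "'a set \<Rightarrow> nat set \<Rightarrow> (nat \<Rightarrow> 'a \<Rightarrow> real) \<Rightarrow> bool" where
  "lin_indep_funs_on A I g \<longleftrightarrow>
     (\<forall>c. (\<forall>x\<in>A. (\<Sum>i\<in>I. c i * g i x) = 0) \<longrightarrow> (\<forall>i\<in>I. c i = 0))"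

text \<open>The support \<open>S \<theta>\<close> may depend on \<open>\<theta>\<close>; only regularity excludes this.  The vectors
  \<open>w\<close> and \<open>f\<close> of length \<open>s\<close> are indexed by \<open>{1..s}\<close>; their other entries are irrelevant.
  Positivity of the base on the support is what makes its real power meaningful.\<close>

definition M_family ::
  "real \<Rightarrow> nat \<Rightarrow> (real^'d \<Rightarrow> real) \<Rightarrow> (nat \<Rightarrow> real^'k \<Rightarrow> real) \<Rightarrow> (nat \<Rightarrow> real^'d \<Rightarrow> real) \<Rightarrow>
   (real^'k) set \<Rightarrow> (real^'k \<Rightarrow> (real^'d) set) \<Rightarrow> (real^'k \<Rightarrow> real^'d \<Rightarrow> real) \<Rightarrow> bool" where
  "M_family \<alpha> s h w f \<Theta> S p \<longleftrightarrow>
     \<alpha> \<noteq> 1 \<and> open \<Theta> \<and>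
     (\<forall>\<theta>\<in>\<Theta>. prob_density (p \<theta>)) \<and>
     (\<forall>\<theta>\<in>\<Theta>. S \<theta> = {x. p \<theta> x > 0}) \<and>
     (\<forall>i\<in>{1..s}. w i differentiable_on \<Theta>) \<and>
     (\<exists>Z. Z differentiable_on \<Theta> \<and>
        (\<forall>\<theta>\<in>\<Theta>.
           (\<forall>x\<in>S \<theta>.
              h x + (\<Sum>i=1..s. w i \<theta> * f i x) > 0 \<and>
              p \<theta> x = Z \<theta> * (h x + (\<Sum>i=1..s. w i \<theta> * f i x)) powr (1 / (\<alpha> - 1))) \<and>
           (\<forall>x. x \<notin> S \<theta> \<longrightarrow> p \<theta> x = 0)))"

definition regular_M_family ::
  "real \<Rightarrow> nat \<Rightarrow> (real^'d \<Rightarrow> real) \<Rightarrow> (nat \<Rightarrow> real^'k \<Rightarrow> real) \<Rightarrow> (nat \<Rightarrow> real^'d \<Rightarrow> real) \<Rightarrow>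
   (real^'k) set \<Rightarrow> (real^'k \<Rightarrow> (real^'d) set) \<Rightarrow> (real^'k \<Rightarrow> real^'d \<Rightarrow> real) \<Rightarrow> bool" where
  "regular_M_family \<alpha> s h w f \<Theta> S p \<longleftrightarrow>
     M_family \<alpha> s h w f \<Theta> S p \<and>
     (\<forall>\<theta>\<in>\<Theta>. \<forall>\<theta>'\<in>\<Theta>. S \<theta> = S \<theta>') \<and>
     s = CARD('k) \<and>
     lin_indep_funs_on \<Theta> {0..s} (\<lambda>i. if i = 0 then (\<lambda>_. 1) else w i) \<and>
     (\<forall>\<theta>\<in>\<Theta>. lin_indep_funs_on (S \<theta>) {1..s} f)"

section \<open>Student distributions\<close>

definition pos_def :: "real^'d^'d \<Rightarrow> bool" where
  "pos_def A \<longleftrightarrow> transpose A = A \<and> (\<forall>x. x \<noteq> 0 \<longrightarrow> 0 < x \<bullet> (A *v x))"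

definition student_alpha :: "nat \<Rightarrow> real \<Rightarrow> real" where
  "student_alpha d \<nu> = 1 - 2 / (\<nu> + real d)"

definition student_b :: "nat \<Rightarrow> real \<Rightarrow> real" where
  "student_b d \<nu> = (1 - student_alpha d \<nu>) / (2 - real d * (1 - student_alpha d \<nu>))"

lemma student_b_eq: "0 < \<nu> \<Longrightarrow> student_b d \<nu> = 1 / \<nu>"
proof -
  assume \<nu>: "0 < \<nu>"
  then have pos: "0 < \<nu> + real d" by simp
  then have "2 - real d * (1 - student_alpha d \<nu>) = 2 * \<nu> / (\<nu> + real d)"
    by (simp add: student_alpha_def field_simps)
  moreover have "1 - student_alpha d \<nu> = 2 / (\<nu> + real d)"
    by (simp add: student_alpha_def)
  ultimately show ?thesis
    using \<nu> pos by (simp only: student_b_def) (simp add: divide_simps)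
qed

definition student_density :: "real \<Rightarrow> real^'d \<Rightarrow> real^'d^'d \<Rightarrow> real^'d \<Rightarrow> real" where
  "student_density \<nu> \<mu> A x =
     Gamma ((\<nu> + real CARD('d)) / 2) /
       (Gamma (\<nu> / 2) * (\<nu> * pi) powr (real CARD('d) / 2) * sqrt (det A)) *
     (1 + student_b CARD('d) \<nu> * ((x - \<mu>) \<bullet> (matrix_inv A *v (x - \<mu>))))
       powr (1 / (student_alpha CARD('d) \<nu> - 1))"

instance uprod :: (finite) finite
  by standard simp

text \<open>A parameter consists of the means \<open>\<mu>\<^sub>i\<close> and one entry of the symmetric matrix for each
  unordered pair \<open>{i, j}\<close>, that is, for each position \<open>i \<le> j\<close> of the upper triangle.\<close>

type_synonym 'd student_param = "real^('d + 'd uprod)"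

lemma card_student_param: "CARD('d::finite + 'd uprod) = CARD('d) * (CARD('d) + 3) div 2"
  by (simp add: card_UNIV_uprod algebra_simps)

definition student_mu :: "'d::finite student_param \<Rightarrow> real^'d" where
  "student_mu \<theta> = (\<chi> i. \<theta> $ Inl i)"

definition student_Sigma :: "'d::finite student_param \<Rightarrow> real^'d^'d" where
  "student_Sigma \<theta> = (\<chi> i j. \<theta> $ Inr (Upair i j))"

definition student_Theta :: "'d::finite student_param set" where
  "student_Theta = {\<theta>. pos_def (student_Sigma \<theta>)}"

definition student_family :: "real \<Rightarrow> 'd::finite student_param \<Rightarrow> real^'d \<Rightarrow> real" where
  "student_family \<nu> \<theta> = student_density \<nu> (student_mu \<theta>) (student_Sigma \<theta>)"

end

theory Submission
  imports Defs
begin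

text \<open>Expanding the quadratic form in the density leaves the constant term
  \<open>C(\<theta>) = 1 + \<mu>\<^sup>T \<Sigma>\<inverse> \<mu> / \<nu>\<close>, which still depends on \<open>\<theta>\<close>. Pulling it out of the power into the
  normalizing factor gives the required form with \<open>h = 1\<close>, the statistics \<open>x\<^sub>i\<close> and \<open>x\<^sub>i x\<^sub>j\<close>, and
  coefficients that are the entries of \<open>- 2 \<Sigma>\<inverse> \<mu>\<close> and \<open>\<Sigma>\<inverse>\<close> divided by \<open>\<nu> C(\<theta>)\<close>.
  A linear relation between \<open>1\<close> and the coefficients, multiplied by \<open>\<nu> C(\<theta>)\<close>, is linear in
  \<open>\<eta> = \<Sigma>\<inverse> \<mu>\<close> and in \<open>P = \<Sigma>\<inverse>\<close>, apart from a multiple of \<open>\<nu> + \<eta>\<^sup>T P\<inverse> \<eta>\<close>. As \<open>\<eta>\<close> and \<open>P\<close> vary freely,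
  testing it at \<open>\<eta> = 0\<close>, \<open>P = t I + v v\<^sup>T\<close> and then at \<open>P = I\<close> forces it to be trivial.\<close>

section \<open>Linear change of variables for the Lebesgue integral\<close>

text \<open>Along each line parallel to b the function g is constant, so the map acts there as a
  translation; Tonelli's theorem reduces the claim to these lines.\<close>

lemma nn_integral_lborel_shear:
  fixes F :: "'a::euclidean_space \<Rightarrow> ennreal"
  assumes [measurable]: "F \<in> borel_measurable borel" "g \<in> borel_measurable borel"
    and b: "b \<in> Basis" and g: "\<And>x t. g (x + t *\<^sub>R b) = (g x :: real)"
  shows "(\<integral>\<^sup>+x. F (x + g x *\<^sub>R b) \<partial>lborel) = (\<integral>\<^sup>+x. F x \<partial>lborel)"
proof -
  interpret product_sigma_finite "\<lambda>_::'a. lborel :: real measure"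
    by standard
  define B where "B = Basis - {b}"
  have B: "finite B" "b \<notin> B" "Basis = insert b B"
    using b by (auto simp: B_def)
  define v where "v = (\<lambda>x. \<Sum>c\<in>B. x c *\<^sub>R c :: 'a)"
  \<comment> \<open>Iterated integral with the coordinate along b innermost; \<open>v x\<close>
    carries the other coordinates and has b-coordinate 0.\<close>
  have split: "(\<integral>\<^sup>+x. G x \<partial>lborel)
      = (\<integral>\<^sup>+x. (\<integral>\<^sup>+y. G (v x + y *\<^sub>R b) \<partial>lborel) \<partial>Pi\<^sub>M B (\<lambda>_. lborel))"
    if [measurable]: "G \<in> borel_measurable borel" for G :: "'a \<Rightarrow> ennreal"
  proof -
    have [measurable]: "(\<lambda>x. G (\<Sum>c\<in>Basis. x c *\<^sub>R c)) \<in> borel_measurable (Pi\<^sub>M Basis (\<lambda>_. lborel))"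
      by measurable
    have "(\<integral>\<^sup>+x. G x \<partial>lborel) = (\<integral>\<^sup>+x. G (\<Sum>c\<in>Basis. x c *\<^sub>R c) \<partial>Pi\<^sub>M Basis (\<lambda>_. lborel))"
      by (subst lborel_eq) (simp add: nn_integral_distr)
    also have "\<dots> = (\<integral>\<^sup>+x. (\<integral>\<^sup>+y. G (\<Sum>c\<in>Basis. (x(b := y)) c *\<^sub>R c) \<partial>lborel) \<partial>Pi\<^sub>M B (\<lambda>_. lborel))"
      unfolding B(3) by (rule product_nn_integral_insert) (use B in \<open>simp_all flip: B(3)\<close>)
    also have "(\<lambda>x. \<integral>\<^sup>+y. G (\<Sum>c\<in>Basis. (x(b := y)) c *\<^sub>R c) \<partial>lborel)
        = (\<lambda>x. \<integral>\<^sup>+y. G (v x + y *\<^sub>R b) \<partial>lborel)"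
    proof (intro ext nn_integral_cong arg_cong[of _ _ G])
      fix x :: "'a \<Rightarrow> real" and y
      have "(\<Sum>c\<in>B. (x(b := y)) c *\<^sub>R c) = v x"
        unfolding v_def using B by (intro sum.cong) auto
      then show "(\<Sum>c\<in>Basis. (x(b := y)) c *\<^sub>R c) = v x + y *\<^sub>R b"
        unfolding B(3) using B(1,2) by (simp add: add.commute)
    qed
    finally show ?thesis .
  qed
  \<comment> \<open>The factor \<open>1 *\<close> is kept so that the inner integral matches
    \<open>nn_integral_real_affine\<close> with slope 1.\<close>
  have "(\<integral>\<^sup>+x. F (x + g x *\<^sub>R b) \<partial>lborel)
      = (\<integral>\<^sup>+x. (\<integral>\<^sup>+y. F (v x + (g (v x) + 1 * y) *\<^sub>R b) \<partial>lborel) \<partial>Pi\<^sub>M B (\<lambda>_. lborel))"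
    by (subst split) (simp_all add: g scaleR_add_left add_ac)
  also have "\<dots> = (\<integral>\<^sup>+x. F x \<partial>lborel)"
  proof -
    have "(\<integral>\<^sup>+y. F (v x + (g (v x) + 1 * y) *\<^sub>R b) \<partial>lborel) = (\<integral>\<^sup>+y. F (v x + y *\<^sub>R b) \<partial>lborel)" for x
      by (subst (2) nn_integral_real_affine[where c = 1 and t = "g (v x)"]) simp_all
    then show ?thesis by (simp add: split)
  qed
  finally show ?thesis .
qed

lemma Basis_vec_range: "(Basis :: (real^'n) set) = range (\<lambda>i. axis i 1)"
  by (auto simp: Basis_vec_def)

lemma inj_axis_1: "inj (\<lambda>i. axis i 1 :: real^'n)"
  by (auto simp: inj_on_def axis_eq_axis)

text \<open>A coordinate permutation pulls boxes back to boxes with the same side lengths in another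
  order, and Lebesgue measure is determined by its values on boxes.\<close>

lemma nn_integral_lborel_permute:
  fixes F :: "real^'n \<Rightarrow> ennreal"
  assumes [measurable]: "F \<in> borel_measurable borel" and p: "bij (p :: 'n \<Rightarrow> 'n)"
  shows "(\<integral>\<^sup>+x. F (\<chi> i. x $ p i) \<partial>lborel) = (\<integral>\<^sup>+x. F x \<partial>lborel)"
proof -
  let ?T = "\<lambda>x::real^'n. \<chi> i. x $ p i" and ?T' = "\<lambda>x::real^'n. \<chi> i. x $ inv p i"
  have [measurable]: "?T \<in> borel \<rightarrow>\<^sub>M borel"
    by (intro borel_measurable_continuous_onI continuous_intros)
  have "lborel = distr lborel borel ?T"
  proof (rule lborel_eqI)
    fix l u :: "real^'n" assume le: "\<And>b. b \<in> Basis \<Longrightarrow> l \<bullet> b \<le> u \<bullet> b"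
    have le': "l $ i \<le> u $ i" for i
      using le[of "axis i 1"] by (simp add: inner_axis axis_in_Basis_iff)
    have prod_eq: "(\<Prod>b\<in>Basis. w \<bullet> b) = (\<Prod>i\<in>UNIV. w $ i)" for w :: "real^'n"
      unfolding Basis_vec_range by (subst prod.reindex[OF inj_axis_1]) (simp add: inner_axis)
    have "?T -` box l u = box (?T' l) (?T' u)"
      using p by (auto simp: mem_box_cart) (metis bij_inv_eq_iff)+
    then have "emeasure (distr lborel borel ?T) (box l u) = emeasure lborel (box (?T' l) (?T' u))"
      by (simp add: emeasure_distr)
    also have "\<dots> = ennreal (\<Prod>b\<in>Basis. (?T' u - ?T' l) \<bullet> b)"
    proof (rule emeasure_lborel_box)
      show "?T' l \<bullet> b \<le> ?T' u \<bullet> b" if "b \<in> Basis" for b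
        using that le' by (auto simp: Basis_vec_def inner_axis)
    qed
    also have "(\<Prod>b\<in>Basis. (?T' u - ?T' l) \<bullet> b) = (\<Prod>b\<in>Basis. (u - l) \<bullet> b)"
      unfolding prod_eq using prod.reindex_bij_betw[OF bij_imp_bij_inv[OF p], of "\<lambda>i. (u - l) $ i"]
      by simp
    finally show "emeasure (distr lborel borel ?T) (box l u) = ennreal (\<Prod>b\<in>Basis. (u - l) \<bullet> b)" .
  qed simp
  then have "(\<integral>\<^sup>+x. F x \<partial>lborel) = (\<integral>\<^sup>+x. F x \<partial>distr lborel borel ?T)"
    by simp
  then show ?thesis
    by (simp add: nn_integral_distr)
qed

lemma nn_integral_lborel_diagonal:
  fixes F :: "real^'n \<Rightarrow> ennreal"
  assumes [measurable]: "F \<in> borel_measurable borel" and c: "\<And>i. c i \<noteq> 0"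
  shows "(\<integral>\<^sup>+x. F x \<partial>lborel) = ennreal (\<Prod>i\<in>UNIV. \<bar>c i\<bar>) * (\<integral>\<^sup>+x. F (\<chi> i. c i * x $ i) \<partial>lborel)"
proof -
  \<comment> \<open>\<open>lborel_affine_euclidean\<close> indexes its scale factors by basis
    vectors, so the factor of index i is moved to \<open>axis i 1\<close>.\<close>
  define c' where "c' b = c (SOME i. b = axis i 1)" for b :: "real^'n"
  have c': "c' (axis i 1) = c i" for i
    by (simp add: c'_def axis_eq_axis)
  have T: "0 + (\<Sum>j\<in>Basis. (c' j * (x \<bullet> j)) *\<^sub>R j) = (\<chi> i. c i * x $ i)" for x :: "real^'n"
    unfolding Basis_vec_range by (subst sum.reindex[OF inj_axis_1])
      (simp add: c' inner_axis vec_eq_iff, simp add: axis_def if_distrib cong: if_cong)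
  have "lborel = density (distr lborel borel (\<lambda>x::real^'n. 0 + (\<Sum>j\<in>Basis. (c' j * (x \<bullet> j)) *\<^sub>R j)))
      (\<lambda>_. ennreal (\<Prod>j\<in>Basis. \<bar>c' j\<bar>))"
    by (rule lborel_affine_euclidean) (use c in \<open>auto simp: Basis_vec_range c'\<close>)
  also have "(\<Prod>j\<in>Basis. \<bar>c' j\<bar>) = (\<Prod>i\<in>UNIV. \<bar>c i\<bar>)"
    unfolding Basis_vec_range by (subst prod.reindex[OF inj_axis_1]) (simp add: c')
  finally have *: "lborel = density (distr lborel borel (\<lambda>x::real^'n. \<chi> i. c i * x $ i))
      (\<lambda>_. ennreal (\<Prod>i\<in>UNIV. \<bar>c i\<bar>))"
    unfolding T .
  have [measurable]: "(\<lambda>x::real^'n. \<chi> i. c i * x $ i) \<in> borel \<rightarrow>\<^sub>M borel"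
    by (intro borel_measurable_continuous_onI continuous_intros)
  show ?thesis
    by (subst *) (simp add: nn_integral_density nn_integral_distr nn_integral_cmult)
qed

lemma borel_measurable_matrix_vector_mult [measurable]:
  "(\<lambda>x. A *v x) \<in> borel_measurable (borel :: (real^'n) measure)" for A :: "real^'n^'m"
  by (intro borel_measurable_continuous_onI linear_continuous_on matrix_vector_mul_bounded_linear)

text \<open>The library's change of variables for linear maps assumes a well-ordered index type.\<close>

lemma nn_integral_lborel_linear:
  fixes A :: "real^'n^'n" and F :: "real^'n \<Rightarrow> ennreal"
  assumes "F \<in> borel_measurable borel" "det A \<noteq> 0"
  shows "(\<integral>\<^sup>+x. F x \<partial>lborel) = ennreal \<bar>det A\<bar> * (\<integral>\<^sup>+x. F (A *v x) \<partial>lborel)"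
proof -
  \<comment> \<open>F is quantified inside the induction predicate because the product case needs
    the claim for B at the integrand \<open>F (A *v x)\<close>.\<close>
  let ?P = "\<lambda>A::real^'n^'n. det A \<noteq> 0 \<longrightarrow> (\<forall>F\<in>borel_measurable borel.
    (\<integral>\<^sup>+x. F x \<partial>lborel) = ennreal \<bar>det A\<bar> * (\<integral>\<^sup>+x. F (A *v x) \<partial>lborel))"
  \<comment> \<open>Both sides respect products, so elementary matrices suffice: a zero row
    (excluded by the determinant), diagonal matrices, coordinate swaps, and adding one coordinate to
    another.\<close>
  have "?P A"
  proof (induction A rule: induct_matrix_elementary_alt)
    case (1 A B)
    show ?case
    proof (intro impI ballI)
      fix F :: "real^'n \<Rightarrow> ennreal"
      assume [measurable]: "F \<in> borel_measurable borel" and "det (A ** B) \<noteq> 0"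
      then have "det A \<noteq> 0" "det B \<noteq> 0" by (auto simp: det_mul)
      moreover have "(\<lambda>x. F (A *v x)) \<in> borel_measurable borel" by measurable
      ultimately have "(\<integral>\<^sup>+x. F x \<partial>lborel) = ennreal \<bar>det A\<bar> * (\<integral>\<^sup>+x. F (A *v x) \<partial>lborel)"
        and "(\<integral>\<^sup>+x. F (A *v x) \<partial>lborel) = ennreal \<bar>det B\<bar> * (\<integral>\<^sup>+x. F (A *v (B *v x)) \<partial>lborel)"
        using 1 \<open>F \<in> _\<close> by blast+
      then show "(\<integral>\<^sup>+x. F x \<partial>lborel) = ennreal \<bar>det (A ** B)\<bar> * (\<integral>\<^sup>+x. F ((A ** B) *v x) \<partial>lborel)"
        by (simp add: det_mul abs_mult ennreal_mult matrix_vector_mul_assoc mult.assoc)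
    qed
  next
    case (2 A i)
    then show ?case by (simp add: det_zero_row)
  next
    case (3 A)
    have "A *v x = (\<chi> i. A $ i $ i * x $ i)" for x
    proof (subst vec_eq_iff, intro allI)
      fix i
      have "(A *v x) $ i = (\<Sum>j\<in>UNIV. if j = i then A $ i $ i * x $ i else 0)"
        unfolding matrix_vector_mult_def vec_lambda_beta by (intro sum.cong) (use 3 in auto)
      then show "(A *v x) $ i = (\<chi> i. A $ i $ i * x $ i) $ i" by simp
    qed
    moreover have "det A = (\<Prod>i\<in>UNIV. A $ i $ i)"
      by (rule det_diagonal) (use 3 in auto)
    ultimately show ?case
      using nn_integral_lborel_diagonal[of _ "\<lambda>i. A $ i $ i"] by (auto simp: abs_prod)
  next
    case (4 m n)
    let ?A = "\<chi> i j. mat 1 $ i $ Transposition.transpose m n j :: real^'n^'n"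
    have "?A *v x = (\<chi> i. x $ Transposition.transpose m n i)" for x
    proof -
      have "(?A *v x) $ i = (\<Sum>j\<in>UNIV. if j = Transposition.transpose m n i then x $ j else 0)" for i
        unfolding matrix_vector_mult_def vec_lambda_beta
        by (intro sum.cong) (auto simp: mat_def transpose_eq_iff)
      then show ?thesis by (simp add: vec_eq_iff)
    qed
    moreover have "\<bar>det ?A\<bar> = 1"
      using det_permute_columns[of "Transposition.transpose m n" "mat 1 :: real^'n^'n"] 4
      by (simp add: permutes_swap_id sign_swap_id)
    ultimately show ?case
      by (auto simp: nn_integral_lborel_permute)
  next
    case (5 m n)
    let ?A = "\<chi> i j. of_bool (i = m \<and> j = n \<or> i = j) :: real^'n^'n"
    have "?A *v x = x + x $ n *\<^sub>R axis m 1" for x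
    proof -
      have "(?A *v x) $ i = (\<Sum>j\<in>UNIV. (if j = i then x $ j else 0) + (if j = n then of_bool (i = m) * x $ j else 0))" for i
        unfolding matrix_vector_mult_def vec_lambda_beta
        by (intro sum.cong) (use 5 in auto)
      then show ?thesis by (simp add: vec_eq_iff sum.distrib axis_def)
    qed
    moreover have "?A = (\<chi> k. if k = m then row m (mat 1) + 1 *s row n (mat 1) else row k (mat 1))"
      using 5 by (auto simp: vec_eq_iff row_def mat_def)
    then have "det ?A = 1"
      using det_row_operation[OF 5, of "mat 1 :: real^'n^'n" 1] by simp
    moreover have "(\<lambda>x::real^'n. x $ n) \<in> borel_measurable borel"
      by (intro borel_measurable_continuous_onI continuous_intros)
    \<comment> \<open>As m and n differ, coordinate n does not change along \<open>axis m 1\<close>;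
      this is the invariance that the shear lemma asks for.\<close>
    moreover have "axis m (1::real) $ n = 0"
      using 5 by (simp add: axis_def)
    ultimately show ?case
      by (auto simp: axis_in_Basis_iff intro!: nn_integral_lborel_shear[symmetric])
  qed
  with assms show ?thesis by blast
qed

lemma nn_integral_lborel_translate:
  fixes F :: "'a::euclidean_space \<Rightarrow> ennreal"
  assumes [measurable]: "F \<in> borel_measurable borel"
  shows "(\<integral>\<^sup>+x. F (x - c) \<partial>lborel) = (\<integral>\<^sup>+x. F x \<partial>lborel)"
proof -
  have "(\<integral>\<^sup>+x. F x \<partial>lborel) = (\<integral>\<^sup>+x. F x \<partial>distr lborel borel ((+) (- c)))"
    by (simp add: lborel_distr_plus)
  then show ?thesis
    by (simp add: nn_integral_distr)
qed

section \<open>The radial Student integral\<close>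

lemma nn_integral_gaussian:
  fixes t :: real
  assumes t: "0 < t"
  shows "(\<integral>\<^sup>+y. ennreal (exp (- t * y\<^sup>2)) \<partial>lborel) = ennreal (sqrt (pi / t))"
proof -
  \<comment> \<open>This standard deviation gives the normal density the exponent
    \<open>- t * y\<^sup>2\<close>.\<close>
  let ?\<sigma> = "1 / sqrt (2 * t)"
  have "exp (- t * y\<^sup>2) = sqrt (pi / t) * normal_density 0 ?\<sigma> y" for y
    using t by (simp add: normal_density_def power_divide real_sqrt_divide field_simps)
  then have "(\<integral>\<^sup>+y. ennreal (exp (- t * y\<^sup>2)) \<partial>lborel)
      = (\<integral>\<^sup>+y. ennreal (sqrt (pi / t)) * ennreal (normal_density 0 ?\<sigma> y) \<partial>lborel)"
    using t by (simp add: ennreal_mult)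
  also have "\<dots> = ennreal (sqrt (pi / t)) * (\<integral>\<^sup>+y. ennreal (normal_density 0 ?\<sigma> y) \<partial>lborel)"
    by (simp add: nn_integral_cmult)
  also have "(\<integral>\<^sup>+y. ennreal (normal_density 0 ?\<sigma> y) \<partial>lborel) = 1"
    using t by (subst nn_integral_eq_integral) auto
  finally show ?thesis by simp
qed

text \<open>The Gaussian and Lebesgue measure both factor over the coordinates, which leaves a power
  of the one-dimensional integral.\<close>

lemma nn_integral_gaussian_euclidean:
  assumes t: "0 < t"
  shows "(\<integral>\<^sup>+x. ennreal (exp (- t * (x \<bullet> x))) \<partial>(lborel :: 'a::euclidean_space measure))
    = ennreal ((pi / t) powr (DIM('a) / 2))"
proof -
  have "exp (- t * (x \<bullet> x)) = (\<Prod>b\<in>Basis. exp (- t * (x \<bullet> b)\<^sup>2))" for x :: 'a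
    by (subst euclidean_inner) (simp add: exp_sum[symmetric] sum_distrib_left power2_eq_square sum_negf)
  then have "(\<integral>\<^sup>+x. ennreal (exp (- t * (x \<bullet> x))) \<partial>(lborel :: 'a measure))
      = (\<integral>\<^sup>+x. (\<Prod>b\<in>Basis. ennreal (exp (- t * (x \<bullet> b)\<^sup>2))) \<partial>(lborel :: 'a measure))"
    by (simp add: prod_ennreal)
  also have "\<dots> = (\<Prod>b\<in>(Basis :: 'a set). ennreal (sqrt (pi / t)))"
    by (subst nn_integral_lborel_prod) (simp_all add: nn_integral_gaussian[OF t, simplified])
  also have "\<dots> = ennreal (((pi / t) powr (1/2)) ^ DIM('a))"
    using t by (simp add: ennreal_power powr_half_sqrt)
  also have "((pi / t) powr (1/2)) ^ DIM('a) = (pi / t) powr (DIM('a) / 2)"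
    using t by (simp add: powr_realpow[symmetric] powr_powr)
  finally show ?thesis .
qed

text \<open>Substitute \<open>a * t\<close> in the Gamma integral. Read from right to left, the
  formula writes \<open>a powr (- s)\<close> as a mixture of exponentials.\<close>

lemma nn_integral_Gamma_scaled:
  fixes a s :: real
  assumes a: "0 < a" and s: "0 < s"
  shows "(\<integral>\<^sup>+t. ennreal (indicator {0..} t * t powr (s - 1) * exp (- a * t)) \<partial>lborel)
    = ennreal (Gamma s * a powr (- s))"
proof -
  have "ennreal (Gamma s) = (\<integral>\<^sup>+t. ennreal (indicator {0..} t * t powr (s - 1) / exp t) \<partial>lborel)"
    by (rule Gamma_conv_nn_integral_real[OF s])
  also have "\<dots> = ennreal a * (\<integral>\<^sup>+t. ennreal (indicator {0..} (a * t) * (a * t) powr (s - 1) / exp (a * t)) \<partial>lborel)"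
    using a by (subst nn_integral_real_affine[where c = a and t = 0]) simp_all
  also have "\<dots> = (\<integral>\<^sup>+t. ennreal (a powr s) * ennreal (indicator {0..} t * t powr (s - 1) * exp (- a * t)) \<partial>lborel)"
  proof (subst nn_integral_cmult[symmetric], measurable, intro nn_integral_cong)
    fix t :: real
    have "a * (indicator {0..} (a * t) * (a * t) powr (s - 1) / exp (a * t))
        = a powr s * (indicator {0..} t * t powr (s - 1) * exp (- a * t))"
      using a by (auto simp: indicator_def zero_le_mult_iff powr_mult powr_diff exp_minus field_simps)
    then show "ennreal a * ennreal (indicator {0..} (a * t) * (a * t) powr (s - 1) / exp (a * t))
        = ennreal (a powr s) * ennreal (indicator {0..} t * t powr (s - 1) * exp (- a * t))"
      using a by (simp flip: ennreal_mult)
  qed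
  also have "\<dots> = ennreal (a powr s) * (\<integral>\<^sup>+t. ennreal (indicator {0..} t * t powr (s - 1) * exp (- a * t)) \<partial>lborel)"
    by (rule nn_integral_cmult) measurable
  finally have "ennreal (a powr - s) * ennreal (Gamma s)
      = (ennreal (a powr - s) * ennreal (a powr s)) * (\<integral>\<^sup>+t. ennreal (indicator {0..} t * t powr (s - 1) * exp (- a * t)) \<partial>lborel)"
    by (simp add: mult.assoc)
  also have "ennreal (a powr - s) * ennreal (a powr s) = 1"
    using a by (simp flip: ennreal_mult powr_add)
  finally show ?thesis
    using a s by (simp add: ennreal_mult' Gamma_real_nonneg mult.commute)
qed

text \<open>Writing the integrand as a Gamma mixture of Gaussians reduces the integral to
  \<open>nn_integral_gaussian_euclidean\<close> by Tonelli's theorem.\<close>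

lemma nn_integral_student_kernel:
  fixes c s :: real
  assumes c: "0 < c" and s: "DIM('a) / 2 < s"
  shows "(\<integral>\<^sup>+x. ennreal ((1 + c * (x \<bullet> x)) powr (- s)) \<partial>(lborel :: 'a::euclidean_space measure))
    = ennreal (Gamma (s - DIM('a) / 2) / Gamma s * (pi / c) powr (DIM('a) / 2))"
proof -
  let ?n = "DIM('a) / 2"
  have s0: "0 < s" by (rule le_less_trans[OF _ s]) simp
  then have \<Gamma>: "0 < Gamma s" by (rule Gamma_real_pos)
  let ?g = "\<lambda>t. indicator {0..} t * t powr (s - 1) :: real"
  have "ennreal (Gamma s) * (\<integral>\<^sup>+x. ennreal ((1 + c * (x \<bullet> x)) powr (- s)) \<partial>(lborel :: 'a measure))
      = (\<integral>\<^sup>+x. ennreal (Gamma s * (1 + c * (x \<bullet> x)) powr (- s)) \<partial>(lborel :: 'a measure))"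
    using \<Gamma> by (subst nn_integral_cmult[symmetric]) (auto simp: ennreal_mult)
  \<comment> \<open>The Gamma integral with rate \<open>1 + c * (x \<bullet> x)\<close>.\<close>
  also have "\<dots> = (\<integral>\<^sup>+x. (\<integral>\<^sup>+t. ennreal (?g t * exp (- (1 + c * (x \<bullet> x)) * t)) \<partial>lborel) \<partial>(lborel :: 'a measure))"
    using c s0 by (intro nn_integral_cong nn_integral_Gamma_scaled[symmetric]) (auto intro: add_pos_nonneg)
  also have "\<dots> = (\<integral>\<^sup>+t. (\<integral>\<^sup>+x. ennreal (?g t * exp (- (1 + c * (x \<bullet> x)) * t)) \<partial>(lborel :: 'a measure)) \<partial>lborel)"
    by (rule lborel_pair.Fubini') measurable
  \<comment> \<open>For positive t the x-integral is Gaussian with parameter \<open>c * t\<close>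
    and contributes the power \<open>- ?n\<close> of t. What remains is the Gamma integral at
    \<open>s - ?n\<close>, positive by the assumption on s.\<close>
  also have "\<dots> = (\<integral>\<^sup>+t. ennreal ((pi / c) powr ?n) * ennreal (indicator {0..} t * t powr (s - ?n - 1) / exp t) \<partial>lborel)"
  proof (rule nn_integral_cong)
    fix t :: real
    show "(\<integral>\<^sup>+x. ennreal (?g t * exp (- (1 + c * (x \<bullet> x)) * t)) \<partial>(lborel :: 'a measure))
        = ennreal ((pi / c) powr ?n) * ennreal (indicator {0..} t * t powr (s - ?n - 1) / exp t)"
    proof (cases "0 < t")
      case True
      have "(\<integral>\<^sup>+x. ennreal (?g t * exp (- (1 + c * (x \<bullet> x)) * t)) \<partial>(lborel :: 'a measure))
          = (\<integral>\<^sup>+x. ennreal (?g t * exp (- t)) * ennreal (exp (- (c * t) * (x \<bullet> x))) \<partial>(lborel :: 'a measure))"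
        by (intro nn_integral_cong) (simp add: algebra_simps exp_diff exp_minus field_simps flip: ennreal_mult)
      also have "\<dots> = ennreal (?g t * exp (- t)) * ennreal ((pi / (c * t)) powr ?n)"
        using True c by (subst nn_integral_cmult) (auto simp: nn_integral_gaussian_euclidean[simplified])
      also have "\<dots> = ennreal ((pi / c) powr ?n) * ennreal (indicator {0..} t * t powr (s - ?n - 1) / exp t)"
      proof -
        have "t powr (s - 1) * (pi / (c * t)) powr ?n = (pi / c) powr ?n * t powr (s - ?n - 1)"
        proof -
          have "(pi / (c * t)) powr ?n = (pi / c) powr ?n * t powr (- ?n)"
            using True c by (simp add: powr_divide powr_mult powr_minus field_simps)
          moreover have "t powr (s - ?n - 1) = t powr (s - 1) * t powr (- ?n)"
            by (subst powr_add[symmetric]) (simp add: algebra_simps)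
          ultimately show ?thesis by simp
        qed
        then show ?thesis
          using True by (simp add: exp_minus field_simps flip: ennreal_mult)
      qed
      finally show ?thesis .
    next
      case False
      \<comment> \<open>At \<open>t = 0\<close> both sides vanish because
        \<open>0 powr a = 0\<close>; for negative t the indicator is 0.\<close>
      then have "t < 0 \<or> t = 0" by auto
      then show ?thesis by (auto simp: indicator_def)
    qed
  qed
  also have "\<dots> = ennreal ((pi / c) powr ?n) * ennreal (Gamma (s - ?n))"
    using s by (subst nn_integral_cmult) (auto simp: Gamma_conv_nn_integral_real)
  finally have "ennreal (1 / Gamma s) * ennreal (Gamma s) * (\<integral>\<^sup>+x. ennreal ((1 + c * (x \<bullet> x)) powr (- s)) \<partial>(lborel :: 'a measure))
      = ennreal (1 / Gamma s) * (ennreal ((pi / c) powr ?n) * ennreal (Gamma (s - ?n)))"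
    by (simp add: mult.assoc)
  moreover have "ennreal (1 / Gamma s) * ennreal (Gamma s) = 1"
    using \<Gamma> by (simp flip: ennreal_mult)
  moreover have "0 \<le> Gamma (s - ?n)"
    using s by (intro less_imp_le Gamma_real_pos) simp
  ultimately show ?thesis
    using \<Gamma> by (simp add: mult_ac flip: ennreal_mult)
qed

section \<open>Positive definite matrices\<close>

lemma pos_def_symmetric: "pos_def A \<Longrightarrow> transpose A = A"
  and pos_def_positive: "pos_def A \<Longrightarrow> x \<noteq> 0 \<Longrightarrow> 0 < x \<bullet> (A *v x)"
  by (auto simp: pos_def_def)

lemma pos_def_nonneg: "pos_def A \<Longrightarrow> 0 \<le> x \<bullet> (A *v x)"
  by (cases "x = 0") (auto dest: pos_def_positive[of A x])

lemma symmetric_inner_commute: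
  fixes A :: "real^'n^'n"
  assumes "transpose A = A"
  shows "x \<bullet> (A *v y) = y \<bullet> (A *v x)"
  by (metis assms dot_lmul_matrix inner_commute transpose_matrix_vector)

text \<open>\<open>matrix_inv\<close> is a chosen two-sided inverse; for square matrices a right
  inverse is two-sided, and such inverses are unique.\<close>

lemma matrix_inv_unique:
  fixes A B :: "real^'n^'n"
  assumes "A ** B = mat 1"
  shows "matrix_inv A = B"
proof -
  have BA: "B ** A = mat 1" using assms matrix_left_right_inverse by blast
  have "\<exists>A'. A ** A' = mat 1 \<and> A' ** A = mat 1" using assms BA by blast
  then have "matrix_inv A ** A = mat 1"
    unfolding matrix_inv_def by (rule someI2_ex) simp
  then show ?thesis
    by (metis assms matrix_mul_assoc matrix_mul_lid matrix_mul_rid)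
qed

text \<open>Gram-Schmidt for the inner product defined by A, adding one index of I at a
  time.\<close>

lemma exists_conjugate_family:
  fixes A :: "real^'n^'n"
  assumes A: "pos_def A"
  shows "\<exists>v :: 'n \<Rightarrow> real^'n. \<forall>i\<in>I. \<forall>j\<in>I. v i \<bullet> (A *v v j) = of_bool (i = j)"
proof -
  have "finite I" by simp
  then show ?thesis
  proof (induction I)
    case (insert k I)
    then obtain v where v: "\<And>i j. i \<in> I \<Longrightarrow> j \<in> I \<Longrightarrow> v i \<bullet> (A *v v j) = of_bool (i = j)"
      by blast
    \<comment> \<open>Fewer than \<open>CARD('n)\<close> vectors \<open>A *v v i\<close> cannot span
      the space, so some nonzero x is orthogonal to all of them, that is, A-orthogonal to every
      \<open>v i\<close>. Dividing by q normalizes it.\<close>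
    have "dim ((\<lambda>i. A *v v i) ` I) \<le> card ((\<lambda>i. A *v v i) ` I)"
      by (rule dim_le_card') simp
    also have "\<dots> \<le> card I" by (rule card_image_le) simp
    also have "\<dots> < card (insert k I)" using insert by simp
    also have "\<dots> \<le> CARD('n)" by (rule card_mono) simp_all
    finally have "dim ((\<lambda>i. A *v v i) ` I) < DIM(real^'n)" by simp
    then obtain x where x: "x \<noteq> 0" and orth: "\<And>y. y \<in> span ((\<lambda>i. A *v v i) ` I) \<Longrightarrow> orthogonal x y"
      using orthogonal_to_subspace_exists by metis
    define q where "q = sqrt (x \<bullet> (A *v x))"
    have q: "0 < q" "q * q = x \<bullet> (A *v x)"
      using pos_def_positive[OF A x] by (simp_all add: q_def)
    define u where "u = (1 / q) *\<^sub>R x"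
    have u1: "u \<bullet> (A *v v i) = 0" if "i \<in> I" for i
      using orth[of "A *v v i"] that by (auto simp: u_def orthogonal_def span_base)
    then have u2: "v i \<bullet> (A *v u) = 0" if "i \<in> I" for i
      using that symmetric_inner_commute[OF pos_def_symmetric[OF A]] by metis
    have u3: "u \<bullet> (A *v u) = 1"
      using q by (simp add: u_def matrix_vector_mult_scaleR flip: q(2))
    show ?case
      by (rule exI[of _ "v(k := u)"]) (use insert v u1 u2 u3 in auto)
  qed simp
qed

text \<open>The columns of L are an A-orthonormal basis. L plays the role of an inverse square root
  of A.\<close>

lemma pos_def_factorization:
  fixes A :: "real^'n^'n"
  assumes A: "pos_def A"
  obtains L :: "real^'n^'n" where "transpose L ** A ** L = mat 1"
proof -
  obtain v :: "'n \<Rightarrow> real^'n" where v: "\<And>i j. v i \<bullet> (A *v v j) = of_bool (i = j)"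
    using exists_conjugate_family[OF A, of UNIV] by auto
  define L where "L = (\<chi> i j. v j $ i)"
  have "(transpose L ** A ** L) $ i $ j = v i \<bullet> (A *v v j)" for i j
    by (simp add: L_def transpose_def matrix_matrix_mult_def matrix_vector_mult_def inner_vec_def
        sum_distrib_left sum_distrib_right mult.assoc)
      (rule sum.swap)
  then have "transpose L ** A ** L = mat 1"
    by (simp add: vec_eq_iff v mat_def)
  then show ?thesis by (rule that)
qed

text \<open>One-sided inverses of square matrices are two-sided, so L may be moved from the right
  end of the product to the left; the last claim follows by taking determinants.\<close>

lemma pos_def_factorization_inverse:
  fixes A L :: "real^'n^'n"
  assumes L: "transpose L ** A ** L = mat 1"
  shows "A ** (L ** transpose L) = mat 1"
    and "matrix_inv A = L ** transpose L"
    and "(det L)\<^sup>2 * det A = 1"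
proof -
  have "L ** (transpose L ** A) = mat 1"
    using L matrix_left_right_inverse by blast
  then show *: "A ** (L ** transpose L) = mat 1"
    by (metis matrix_left_right_inverse matrix_mul_assoc)
  then show "matrix_inv A = L ** transpose L"
    by (rule matrix_inv_unique)
  have "det (transpose L ** A ** L) = 1"
    by (simp add: L)
  then show "(det L)\<^sup>2 * det A = 1"
    by (simp add: det_mul det_transpose power2_eq_square mult_ac)
qed

lemma det_pos_def: "0 < det A" if A: "pos_def A" for A :: "real^'n^'n"
proof -
  obtain L :: "real^'n^'n" where "transpose L ** A ** L = mat 1"
    using pos_def_factorization[OF A] .
  then have "(det L)\<^sup>2 * det A = 1"
    by (rule pos_def_factorization_inverse)
  then show ?thesis
    by (metis zero_less_one zero_le_power2 mult_nonneg_nonpos not_less)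
qed

lemma pos_def_mult_inverse: "A ** matrix_inv A = mat 1" if "pos_def A" for A :: "real^'n^'n"
  using pos_def_factorization[OF that] pos_def_factorization_inverse by metis

lemma pos_def_matrix_inv: "pos_def (matrix_inv A)" if A: "pos_def A" for A :: "real^'n^'n"
proof -
  obtain L :: "real^'n^'n" where L: "transpose L ** A ** L = mat 1"
    using pos_def_factorization[OF A] .
  let ?B = "matrix_inv A"
  have B: "?B = L ** transpose L" and inv: "A ** ?B = mat 1"
    using pos_def_factorization_inverse[OF L] by simp_all
  have "transpose ?B = ?B"
    by (simp add: B matrix_transpose_mul)
  moreover have "0 < x \<bullet> (?B *v x)" if "x \<noteq> 0" for x
  proof -
    \<comment> \<open>With \<open>y = ?B *v x\<close> this turns the form of \<open>?B\<close> at x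
      into the form of A at y.\<close>
    have *: "A *v (?B *v x) = x" by (simp add: matrix_vector_mul_assoc inv)
    then have "?B *v x \<noteq> 0" using that by auto
    from pos_def_positive[OF A this] show ?thesis
      by (simp add: * inner_commute)
  qed
  ultimately show ?thesis by (simp add: pos_def_def)
qed

lemma matrix_inv_matrix_inv: "matrix_inv (matrix_inv A) = A" if "pos_def A" for A :: "real^'n^'n"
  by (rule matrix_inv_unique) (use pos_def_mult_inverse[OF that] matrix_left_right_inverse in blast)

section \<open>The Student density\<close>

lemma student_exponent:
  assumes "0 < \<nu>"
  shows "1 / (student_alpha n \<nu> - 1) = - ((\<nu> + real n) / 2)"
proof -
  have "0 < \<nu> + real n" using assms by simp
  then show ?thesis by (simp add: student_alpha_def field_simps)
qed

text \<open>The factor of the normalizing constant that is free of the parameter; the type argument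
  supplies the dimension.\<close>

definition student_norm :: "'d itself \<Rightarrow> real \<Rightarrow> real" where
  "student_norm _ \<nu> = Gamma ((\<nu> + real CARD('d)) / 2) / (Gamma (\<nu> / 2) * (\<nu> * pi) powr (real CARD('d) / 2))"

lemma student_norm_pos: "0 < \<nu> \<Longrightarrow> 0 < student_norm TYPE('d) \<nu>"
  unfolding student_norm_def
  by (intro divide_pos_pos mult_pos_pos Gamma_real_pos add_pos_nonneg) simp_all

lemma student_density_eq:
  fixes \<mu> x :: "real^'d"
  assumes "0 < \<nu>"
  shows "student_density \<nu> \<mu> A x = student_norm TYPE('d) \<nu> / sqrt (det A) *
    (1 + 1 / \<nu> * ((x - \<mu>) \<bullet> (matrix_inv A *v (x - \<mu>)))) powr (- ((\<nu> + real CARD('d)) / 2))"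
  using assms by (simp add: student_density_def student_norm_def student_b_eq student_exponent)

lemma student_base_pos:
  assumes "0 < \<nu>" "pos_def A"
  shows "0 < 1 + 1 / \<nu> * (y \<bullet> (matrix_inv A *v y))"
  using assms pos_def_nonneg[OF pos_def_matrix_inv[OF assms(2)], of y]
  by (intro add_pos_nonneg mult_nonneg_nonneg) simp_all

lemma student_density_pos:
  fixes \<mu> :: "real^'d"
  assumes "0 < \<nu>" "pos_def A"
  shows "0 < student_density \<nu> \<mu> A x"
  using student_base_pos[OF assms, of "x - \<mu>"] student_norm_pos[OF assms(1), where 'd = 'd] det_pos_def[OF assms(2)]
  by (simp add: student_density_eq[OF assms(1)])

text \<open>The substitution \<open>y = transpose L *v (x - \<mu>)\<close> makes the quadratic form
  radial. Its determinant satisfies \<open>\<bar>det L\<bar> * sqrt (det A) = 1\<close>, which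
  absorbs the determinant in the density and leaves the kernel integral.\<close>

lemma nn_integral_student_density:
  fixes \<mu> :: "real^'d"
  assumes \<nu>: "0 < \<nu>" and A: "pos_def A"
  shows "(\<integral>\<^sup>+x. ennreal (student_density \<nu> \<mu> A x) \<partial>lborel) = 1"
proof -
  obtain L :: "real^'d^'d" where L: "transpose L ** A ** L = mat 1"
    using pos_def_factorization[OF A] .
  let ?s = "(\<nu> + real CARD('d)) / 2"
  define C where "C = student_norm TYPE('d) \<nu> / sqrt (det A)"
  define G where "G = (\<lambda>y::real^'d. ennreal ((1 + 1 / \<nu> * (y \<bullet> y)) powr (- ?s)))"
  have [measurable]: "G \<in> borel_measurable borel" unfolding G_def by measurable
  have C: "0 \<le> C"
    using student_norm_pos[OF \<nu>, where 'd = 'd] det_pos_def[OF A] by (simp add: C_def less_imp_le)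
  have detL: "det L \<noteq> 0" and abs_detL: "\<bar>det L\<bar> * sqrt (det A) = 1"
    using pos_def_factorization_inverse(3)[OF L]
    by (auto simp flip: real_sqrt_abs real_sqrt_mult)
  have quad: "y \<bullet> (matrix_inv A *v y) = (transpose L *v y) \<bullet> (transpose L *v y)" for y
    unfolding pos_def_factorization_inverse(2)[OF L]
    by (metis dot_lmul_matrix matrix_vector_mul_assoc transpose_matrix_vector transpose_transpose)
  have "ennreal (student_density \<nu> \<mu> A x) = ennreal C * G (transpose L *v (x - \<mu>))" for x
    unfolding student_density_eq[OF \<nu>] C_def[symmetric] quad G_def by (rule ennreal_mult[OF C]) simp
  then have "(\<integral>\<^sup>+x. ennreal (student_density \<nu> \<mu> A x) \<partial>lborel)
      = (\<integral>\<^sup>+x. ennreal C * G (transpose L *v (x - \<mu>)) \<partial>lborel)"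
    by simp
  also have "\<dots> = ennreal C * (\<integral>\<^sup>+x. G (transpose L *v x) \<partial>lborel)"
    using nn_integral_lborel_translate[of "\<lambda>x. ennreal C * G (transpose L *v x)" \<mu>]
    by (simp add: nn_integral_cmult del: transpose_matrix_vector)
  also have "\<dots> = ennreal (student_norm TYPE('d) \<nu>) * (ennreal \<bar>det L\<bar> * (\<integral>\<^sup>+x. G (transpose L *v x) \<partial>lborel))"
  proof -
    have "C = student_norm TYPE('d) \<nu> * \<bar>det L\<bar>"
      using abs_detL det_pos_def[OF A] by (simp add: C_def field_simps)
    then show ?thesis
      using student_norm_pos[OF \<nu>, where 'd = 'd] by (simp add: ennreal_mult mult.assoc)
  qed
  also have "ennreal \<bar>det L\<bar> * (\<integral>\<^sup>+x. G (transpose L *v x) \<partial>lborel) = (\<integral>\<^sup>+x. G x \<partial>lborel)"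
    using nn_integral_lborel_linear[of G "transpose L"] detL by (simp add: det_transpose del: transpose_matrix_vector)
  also have "\<dots> = ennreal (Gamma (?s - CARD('d) / 2) / Gamma ?s * (pi / (1 / \<nu>)) powr (CARD('d) / 2))"
    unfolding G_def using \<nu> nn_integral_student_kernel[where 'a = "real^'d", of "1 / \<nu>" ?s]
    by (simp add: field_simps)
  also have "ennreal (student_norm TYPE('d) \<nu>) * \<dots> = ennreal (student_norm TYPE('d) \<nu> *
      (Gamma (?s - CARD('d) / 2) / Gamma ?s * (pi / (1 / \<nu>)) powr (CARD('d) / 2)))"
    using student_norm_pos[OF \<nu>, where 'd = 'd] by (intro ennreal_mult'[symmetric]) simp
  also have "student_norm TYPE('d) \<nu> *
      (Gamma (?s - CARD('d) / 2) / Gamma ?s * (pi / (1 / \<nu>)) powr (CARD('d) / 2)) = 1"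
  proof -
    \<comment> \<open>After this shift the Gamma factors and the power of \<open>\<nu> * pi\<close>
      are exactly the reciprocal of \<open>student_norm\<close>.\<close>
    have s: "?s - CARD('d) / 2 = \<nu> / 2" by (simp add: field_simps)
    have "0 < Gamma (\<nu> / 2)" "0 < Gamma ?s"
      using \<nu> by (auto intro!: Gamma_real_pos simp: add_pos_nonneg)
    moreover have "0 < (\<nu> * pi) powr (CARD('d) / 2)"
      using \<nu> by simp
    ultimately show ?thesis
      unfolding s by (simp add: student_norm_def mult.commute[of pi])
  qed
  finally show ?thesis by simp
qed

lemma prob_density_student:
  assumes \<nu>: "0 < \<nu>" and A: "pos_def A"
  shows "prob_density (student_density \<nu> \<mu> A)"
proof -
  have [measurable]: "student_density \<nu> \<mu> A \<in> borel_measurable borel"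
    unfolding student_density_eq[OF \<nu>, abs_def] by measurable
  have "prob_space (density lborel (\<lambda>x. ennreal (student_density \<nu> \<mu> A x)))"
    by (rule prob_spaceI) (simp add: emeasure_density nn_integral_student_density[OF assms])
  then show ?thesis
    using student_density_pos[OF assms] by (simp add: prob_density_def less_imp_le)
qed

section \<open>Dependence on the parameter\<close>

lemma differentiable_prod:
  fixes f :: "'i \<Rightarrow> 'a::real_normed_vector \<Rightarrow> 'b::real_normed_field"
  assumes "\<And>i. i \<in> I \<Longrightarrow> f i differentiable (at x within S)"
  shows "(\<lambda>x. \<Prod>i\<in>I. f i x) differentiable (at x within S)"
proof -
  obtain f' where "\<And>i. i \<in> I \<Longrightarrow> (f i has_derivative f' i) (at x within S)"
    using assms unfolding differentiable_def by metis
  then show ?thesis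
    unfolding differentiable_def by (blast intro: has_derivative_prod)
qed

lemma differentiable_powr:
  fixes f :: "'a::real_normed_vector \<Rightarrow> real"
  assumes "f differentiable (at x within S)" "0 < f x" "x \<in> S"
  shows "(\<lambda>x. f x powr c) differentiable (at x within S)"
  using assms has_derivative_powr[OF _ has_derivative_const] unfolding differentiable_def by blast

lemma differentiable_det:
  fixes M :: "'a::real_normed_vector \<Rightarrow> real^'n^'n"
  assumes "\<And>i j. (\<lambda>x. M x $ i $ j) differentiable (at x within S)"
  shows "(\<lambda>x. det (M x)) differentiable (at x within S)"
  unfolding det_def using assms
  by (intro differentiable_sum ballI differentiable_mult differentiable_prod) auto

text \<open>Cramer's rule for the j-th column of the inverse. It exhibits each entry as a quotient
  of determinants, hence as a differentiable function of the entries of A.\<close>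

lemma matrix_inv_cramer:
  fixes A :: "real^'n^'n"
  assumes "det A \<noteq> 0"
  shows "matrix_inv A $ k $ j
    = det (\<chi> i l. if l = k then axis j 1 $ i else A $ i $ l) / det A"
proof -
  obtain B where "A ** B = mat 1"
    using assms invertible_det_nz[of A] unfolding invertible_def by blast
  then have inv: "A ** matrix_inv A = mat 1"
    by (simp add: matrix_inv_unique)
  have "A *v (matrix_inv A *v axis j 1) = axis j 1"
    by (simp add: matrix_vector_mul_assoc inv)
  then have "matrix_inv A *v axis j 1
      = (\<chi> k. det (\<chi> i l. if l = k then axis j 1 $ i else A $ i $ l) / det A)"
    using cramer[OF assms] by blast
  then show ?thesis
    by (simp add: matrix_vector_mult_basis column_def vec_eq_iff)
qed

lemma differentiable_matrix_inv:
  fixes M :: "'a::real_normed_vector \<Rightarrow> real^'n^'n"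
  assumes M: "\<And>i j. (\<lambda>x. M x $ i $ j) differentiable (at x within S)"
    and det: "\<And>x. x \<in> S \<Longrightarrow> det (M x) \<noteq> 0" and x: "x \<in> S"
  shows "(\<lambda>x. matrix_inv (M x) $ k $ j) differentiable (at x within S)"
\<comment> \<open>Cramer's quotient is known to equal the inverse on S only, which suffices for
  differentiability within S.\<close>
proof (rule differentiable_transform_within[where d = 1])
  have "(\<lambda>y. (\<chi> i l. if l = k then axis j 1 $ i else M y $ i $ l) $ a $ b)
      differentiable (at x within S)" for a b
    by (cases "b = k") (simp_all add: M)
  then show "(\<lambda>y. det (\<chi> i l. if l = k then axis j 1 $ i else M y $ i $ l) / det (M y))
      differentiable (at x within S)"
    using det[OF x] M by (intro differentiable_divide differentiable_det) auto
qed (simp_all add: det x matrix_inv_cramer)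

lemma differentiable_vec_nth: "(\<lambda>x. x $ i) differentiable F" for F :: "(real^'n) filter"
  by (intro bounded_linear_imp_differentiable bounded_linear_vec_nth)

lemma transpose_student_Sigma: "transpose (student_Sigma \<theta>) = student_Sigma \<theta>"
  by (simp add: transpose_def student_Sigma_def vec_eq_iff) (metis Upair_inject)

text \<open>Symmetry of the matrix is built into the parameter, and by homogeneity positivity need
  only be tested on the unit sphere. The sphere is compact, so the tube lemma turns joint openness
  of the positivity condition into a neighbourhood of the parameter.\<close>

lemma open_student_Theta: "open (student_Theta :: 'd::finite student_param set)"
proof -
  let ?W = "{z :: 'd student_param \<times> (real^'d). 0 < snd z \<bullet> (student_Sigma (fst z) *v snd z)}"
  have "continuous_on UNIV (\<lambda>z :: 'd student_param \<times> (real^'d). snd z \<bullet> (student_Sigma (fst z) *v snd z))"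
    unfolding inner_vec_def matrix_vector_mult_def student_Sigma_def vec_lambda_beta inner_real_def
    by (intro continuous_intros)
  then have W: "open ?W"
    by (rule open_Collect_less[OF continuous_on_const])
  show ?thesis
  proof (subst open_subopen, intro ballI)
    fix \<theta> :: "'d student_param" assume "\<theta> \<in> student_Theta"
    then have \<theta>: "pos_def (student_Sigma \<theta>)"
      by (simp add: student_Theta_def)
    have "{\<theta>} \<times> sphere 0 1 \<subseteq> ?W"
    proof clarsimp
      fix x :: "real^'d" assume "norm x = 1"
      then have "x \<noteq> 0" by auto
      then show "0 < x \<bullet> (student_Sigma \<theta> *v x)"
        by (rule pos_def_positive[OF \<theta>])
    qed
    from Elementary_Topology.tube_lemma[OF compact_sphere W this]
    obtain U where U: "\<theta> \<in> U" "open U" "U \<times> sphere 0 1 \<subseteq> ?W"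
      by auto
    have "U \<subseteq> student_Theta"
    proof
      fix \<eta> assume \<eta>: "\<eta> \<in> U"
      have "0 < x \<bullet> (student_Sigma \<eta> *v x)" if "x \<noteq> 0" for x
      proof -
        \<comment> \<open>\<open>sgn x\<close> is x scaled to norm 1; the form at x is a positive
          multiple of the form there.\<close>
        have "(\<eta>, sgn x) \<in> ?W"
          using U(3) \<eta> that by (intro subsetD[OF U(3)]) (simp add: norm_sgn)
        then show ?thesis
          using that by (simp add: sgn_div_norm matrix_vector_mult_scaleR zero_less_mult_iff zero_less_divide_iff)
      qed
      then show "\<eta> \<in> student_Theta"
        by (simp add: student_Theta_def pos_def_def transpose_student_Sigma)
    qed
    with U show "\<exists>T. open T \<and> \<theta> \<in> T \<and> T \<subseteq> student_Theta" by blast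
  qed
qed

section \<open>Sufficient statistics and their coefficients\<close>

definition uprod_rep :: "'a uprod \<Rightarrow> 'a \<times> 'a" where
  "uprod_rep u = (SOME p. case_prod Upair p = u)"

text \<open>Evaluates S at one chosen ordering of the pair; for symmetric S the choice does not
  matter.\<close>

definition uprod_entry :: "('a \<Rightarrow> 'a \<Rightarrow> 'b) \<Rightarrow> 'a uprod \<Rightarrow> 'b" where
  "uprod_entry S u = case_prod S (uprod_rep u)"

text \<open>The number of orderings of the pair: 1 on the diagonal, 2 off it.\<close>

definition uprod_mult :: "'a uprod \<Rightarrow> real" where
  "uprod_mult u = real (card {p. case_prod Upair p = u})"

lemma uprod_rep: "case_prod Upair (uprod_rep u) = u"
  unfolding uprod_rep_def by (rule someI_ex) (cases u, auto)

lemma uprod_entry_Upair: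
  assumes "\<And>i j. S i j = S j i"
  shows "uprod_entry S (Upair i j) = S i j"
  using uprod_rep[of "Upair i j"] assms by (auto simp: uprod_entry_def split: prod.splits)

lemma uprod_mult_pos: "0 < uprod_mult (u :: 'a::finite uprod)"
  using uprod_rep[of u] unfolding uprod_mult_def
  by (metis (mono_tags, lifting) card_gt_0_iff empty_iff finite mem_Collect_eq of_nat_0_less_iff)

lemma uprod_mult_nonzero [simp]: "uprod_mult (u :: 'a::finite uprod) \<noteq> 0"
  using uprod_mult_pos[of u] by simp

text \<open>Group the ordered pairs by their unordered pair; a symmetric S is constant on each
  group.\<close>

lemma sum_symmetric_uprod:
  fixes S :: "'a::finite \<Rightarrow> 'a \<Rightarrow> real"
  assumes S: "\<And>i j. S i j = S j i"
  shows "(\<Sum>i\<in>UNIV. \<Sum>j\<in>UNIV. S i j) = (\<Sum>u\<in>UNIV. uprod_mult u * uprod_entry S u)"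
proof -
  have "(\<Sum>i\<in>UNIV. \<Sum>j\<in>UNIV. S i j) = (\<Sum>p\<in>UNIV. case_prod S p)"
    by (simp add: sum.cartesian_product)
  also have "\<dots> = (\<Sum>u\<in>UNIV. \<Sum>p\<in>{p\<in>UNIV. case_prod Upair p = u}. case_prod S p)"
    by (rule sum.group[symmetric]) simp_all
  also have "\<dots> = (\<Sum>u\<in>UNIV. \<Sum>p\<in>{p\<in>UNIV. case_prod Upair p = u}. uprod_entry S u)"
    by (intro sum.cong refl) (auto simp: uprod_entry_Upair[OF S])
  finally show ?thesis
    by (simp add: uprod_mult_def)
qed

section \<open>Quadratic forms and symmetric matrices\<close>

lemma quadratic_form_eq_sum:
  fixes B :: "real^'n^'n"
  shows "x \<bullet> (B *v x) = (\<Sum>i\<in>UNIV. \<Sum>j\<in>UNIV. B $ i $ j * (x $ i * x $ j))"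
  by (simp add: inner_vec_def matrix_vector_mult_def sum_distrib_left mult_ac)

text \<open>Comparing x with \<open>- x\<close> separates the linear from the quadratic part;
  polarization then recovers the entries of the symmetric matrix B.\<close>

lemma quadratic_function_eq_zero:
  fixes B :: "real^'n^'n"
  assumes B: "transpose B = B" and zero: "\<And>x. a \<bullet> x + x \<bullet> (B *v x) = 0"
  shows "a = 0" "B = 0"
proof -
  have lin: "a \<bullet> x = 0" and quad: "x \<bullet> (B *v x) = 0" for x
    using zero[of x] zero[of "- x"] by (simp_all add: linear_neg[OF matrix_vector_mul_linear])
  show "a = 0" using lin[of a] by simp
  have "x \<bullet> (B *v y) = 0" for x y
    using quad[of "x + y"] quad[of x] quad[of y] symmetric_inner_commute[OF B, of x y]
    by (simp add: matrix_vector_right_distrib inner_add_left inner_add_right)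
  moreover have "axis i 1 \<bullet> (B *v axis j 1) = B $ i $ j" for i j
    by (simp add: inner_axis' matrix_vector_mult_basis column_def)
  ultimately have "B $ i $ j = 0" for i j
    by metis
  then show "B = 0" by (simp add: vec_eq_iff)
qed

definition uprod_matrix :: "('d uprod \<Rightarrow> real) \<Rightarrow> real^'d^'d" where
  "uprod_matrix b = (\<chi> i j. b (Upair i j))"

lemma uprod_matrix_nth [simp]: "uprod_matrix b $ i $ j = b (Upair i j)"
  by (simp add: uprod_matrix_def)

lemma Upair_commute: "Upair i j = Upair j i"
  by simp

lemma transpose_uprod_matrix: "transpose (uprod_matrix b) = uprod_matrix b"
  by (simp add: transpose_def vec_eq_iff Upair_commute)

lemma uprod_matrix_eq_zeroD: "uprod_matrix b = 0 \<Longrightarrow> b u = 0"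
  by (cases u) (metis uprod_matrix_nth zero_index)

lemma symmetric_matrix_nth: "transpose A = A \<Longrightarrow> A $ i $ j = A $ j $ i"
  by (drule sym, erule ssubst) (simp add: transpose_def)

text \<open>The entrywise product of two symmetric matrices is symmetric, so
  \<open>sum_symmetric_uprod\<close> applies. The right-hand side is the trace pairing of the two
  matrices.\<close>

lemma sum_uprod_matrix:
  fixes P :: "real^'d^'d"
  assumes P: "transpose P = P"
  shows "(\<Sum>u\<in>UNIV. b u * (uprod_mult u * uprod_entry (\<lambda>i j. P $ i $ j) u))
    = (\<Sum>i\<in>UNIV. \<Sum>j\<in>UNIV. uprod_matrix b $ i $ j * P $ i $ j)"
proof -
  note sym = symmetric_matrix_nth[OF P]
  have sym': "uprod_matrix b $ i $ j * P $ i $ j = uprod_matrix b $ j $ i * P $ j $ i" for i j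
    by (simp only: uprod_matrix_nth sym[of i j] Upair_commute[of i j])
  have "uprod_entry (\<lambda>i j. uprod_matrix b $ i $ j * P $ i $ j) u
      = b u * uprod_entry (\<lambda>i j. P $ i $ j) u" for u
    using uprod_entry_Upair[of "\<lambda>i j. uprod_matrix b $ i $ j * P $ i $ j", OF sym']
      uprod_entry_Upair[of "\<lambda>i j. P $ i $ j", OF sym]
    by (cases u) simp
  then show ?thesis
    by (subst sum_symmetric_uprod[OF sym']) (simp add: mult_ac)
qed

section \<open>Expansion of the quadratic form into statistics and coefficients\<close>

definition student_offset :: "real \<Rightarrow> 'd::finite student_param \<Rightarrow> real" where
  "student_offset \<nu> \<theta> = 1 + 1 / \<nu> * (student_mu \<theta> \<bullet> (matrix_inv (student_Sigma \<theta>) *v student_mu \<theta>))"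

text \<open>The multiplicity is needed because \<open>student_f\<close> has one statistic per
  unordered pair, while the quadratic form contains each off-diagonal product twice.\<close>

definition student_w :: "real \<Rightarrow> 'd + 'd uprod \<Rightarrow> 'd::finite student_param \<Rightarrow> real" where
  "student_w \<nu> k \<theta> = (case k of
      Inl i \<Rightarrow> - 2 * (matrix_inv (student_Sigma \<theta>) *v student_mu \<theta>) $ i
    | Inr u \<Rightarrow> uprod_mult u * uprod_entry (\<lambda>i j. matrix_inv (student_Sigma \<theta>) $ i $ j) u)
    / (\<nu> * student_offset \<nu> \<theta>)"

definition student_f :: "'d + 'd uprod \<Rightarrow> real^'d::finite \<Rightarrow> real" where
  "student_f k x = (case k of Inl i \<Rightarrow> x $ i | Inr u \<Rightarrow> uprod_entry (\<lambda>i j. x $ i * x $ j) u)"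

lemma sum_UNIV_Plus:
  "(\<Sum>k\<in>UNIV. g k) = (\<Sum>i\<in>UNIV. g (Inl i)) + (\<Sum>u\<in>UNIV. g (Inr u))"
  for g :: "'a::finite + 'b::finite \<Rightarrow> real"
  unfolding UNIV_Plus_UNIV[symmetric] by (simp add: sum.Plus del: UNIV_Plus_UNIV)

text \<open>The offset is the bracket of the density evaluated at \<open>x = 0\<close>.\<close>

lemma student_offset_pos:
  assumes "0 < \<nu>" "\<theta> \<in> student_Theta"
  shows "0 < student_offset \<nu> \<theta>"
  using student_base_pos[OF assms(1)] assms(2) by (simp add: student_offset_def student_Theta_def)

text \<open>Expand the quadratic form around the mean and divide by the constant term, which is
  positive.\<close>

lemma student_base_eq:
  fixes x :: "real^'d::finite"
  assumes \<nu>: "0 < \<nu>" and \<theta>: "\<theta> \<in> student_Theta"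
  shows "1 + 1 / \<nu> * ((x - student_mu \<theta>) \<bullet> (matrix_inv (student_Sigma \<theta>) *v (x - student_mu \<theta>)))
    = student_offset \<nu> \<theta> * (1 + (\<Sum>k\<in>UNIV. student_w \<nu> k \<theta> * student_f k x))"
proof -
  let ?\<mu> = "student_mu \<theta>" and ?P = "matrix_inv (student_Sigma \<theta>)" and ?C = "student_offset \<nu> \<theta>"
  have C: "0 < ?C" by (rule student_offset_pos[OF assms])
  have P: "transpose ?P = ?P"
    using \<theta> by (intro pos_def_symmetric pos_def_matrix_inv) (simp add: student_Theta_def)
  note sym = symmetric_matrix_nth[OF P]
  have sq: "(x - ?\<mu>) \<bullet> (?P *v (x - ?\<mu>)) = x \<bullet> (?P *v x) - 2 * (x \<bullet> (?P *v ?\<mu>)) + ?\<mu> \<bullet> (?P *v ?\<mu>)"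
    using symmetric_inner_commute[OF P, of x ?\<mu>]
    by (simp add: matrix_vector_mult_diff_distrib inner_diff_left inner_diff_right)
  have "x \<bullet> (?P *v x) = (\<Sum>u\<in>UNIV. uprod_mult u * uprod_entry (\<lambda>i j. ?P $ i $ j * (x $ i * x $ j)) u)"
    unfolding quadratic_form_eq_sum by (rule sum_symmetric_uprod) (simp add: sym mult_ac)
  also have "(\<lambda>u. uprod_entry (\<lambda>i j. ?P $ i $ j * (x $ i * x $ j)) u)
      = (\<lambda>u. uprod_entry (\<lambda>i j. ?P $ i $ j) u * student_f (Inr u) x)"
    by (rule ext) (simp add: uprod_entry_def student_f_def split: prod.split)
  finally have "x \<bullet> (?P *v x)
      = (\<Sum>u\<in>UNIV. uprod_mult u * (uprod_entry (\<lambda>i j. ?P $ i $ j) u * student_f (Inr u) x))" .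
  \<comment> \<open>The factor \<open>\<nu> * ?C\<close> undoes the denominator of
    \<open>student_w\<close>.\<close>
  then have quad: "x \<bullet> (?P *v x) = (\<Sum>u\<in>UNIV. \<nu> * ?C * (student_w \<nu> (Inr u) \<theta> * student_f (Inr u) x))"
    using C \<nu> by (simp add: student_w_def mult.assoc)
  have "- 2 * (x \<bullet> (?P *v ?\<mu>)) = (\<Sum>i\<in>UNIV. \<nu> * ?C * (student_w \<nu> (Inl i) \<theta> * student_f (Inl i) x))"
    using C \<nu> by (simp add: student_w_def student_f_def inner_vec_def sum_distrib_left mult_ac)
  with quad sq have "(x - ?\<mu>) \<bullet> (?P *v (x - ?\<mu>))
      = \<nu> * ?C * (\<Sum>k\<in>UNIV. student_w \<nu> k \<theta> * student_f k x) + ?\<mu> \<bullet> (?P *v ?\<mu>)"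
    by (simp add: sum_UNIV_Plus sum_distrib_left distrib_left)
  then show ?thesis
    using \<nu> by (simp add: distrib_left) (simp add: student_offset_def)
qed

section \<open>Linear independence of the statistics and of the coefficients\<close>

lemma student_f_independent:
  fixes c :: "'d::finite + 'd uprod \<Rightarrow> real"
  assumes zero: "\<And>x :: real^'d. (\<Sum>k\<in>UNIV. c k * student_f k x) = 0"
  shows "c k = 0"
proof -
  \<comment> \<open>Dividing by the multiplicity makes the form of \<open>uprod_matrix b\<close>
    equal to the quadratic part of the relation, in which each unordered pair occurs once.\<close>
  define b where "b u = c (Inr u) / uprod_mult u" for u
  define a where "a = (\<chi> i. c (Inl i))"
  have "a \<bullet> x + x \<bullet> (uprod_matrix b *v x) = 0" for x
  proof -
    let ?X = "\<chi> i j. x $ i * x $ j"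
    have "transpose ?X = ?X" by (simp add: transpose_def vec_eq_iff)
    from sum_uprod_matrix[OF this, of b]
    have "x \<bullet> (uprod_matrix b *v x) = (\<Sum>u\<in>UNIV. b u * (uprod_mult u * student_f (Inr u) x))"
      unfolding quadratic_form_eq_sum by (simp add: student_f_def)
    also have "\<dots> = (\<Sum>u\<in>UNIV. c (Inr u) * student_f (Inr u) x)"
      by (simp add: b_def)
    finally show ?thesis
      using zero[of x] by (simp add: sum_UNIV_Plus a_def inner_vec_def student_f_def)
  qed
  from quadratic_function_eq_zero[OF transpose_uprod_matrix this]
  have "a = 0" "uprod_matrix b = 0" .
  then have "c (Inl i) = 0" "b u = 0" for i u
    using uprod_matrix_eq_zeroD[OF \<open>uprod_matrix b = 0\<close>] by (simp_all add: a_def vec_eq_iff)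
  then have "c (Inl i) = 0" "c (Inr u) = 0" for i u
    by (auto simp: b_def)
  then show ?thesis by (cases k) simp_all
qed

text \<open>Take the covariance matrix to be the inverse of P. This lets \<open>\<eta>\<close> and P
  be chosen freely when a relation between the coefficients is tested.\<close>

lemma student_param_exists:
  fixes \<eta> :: "real^'d::finite"
  assumes P: "pos_def P"
  obtains \<theta> where "\<theta> \<in> student_Theta" "matrix_inv (student_Sigma \<theta>) = P"
    "student_mu \<theta> = matrix_inv P *v \<eta>"
proof -
  let ?A = "matrix_inv P"
  define \<theta> :: "'d student_param" where
    "\<theta> = (\<chi> k. case k of Inl i \<Rightarrow> (?A *v \<eta>) $ i | Inr u \<Rightarrow> uprod_entry (\<lambda>i j. ?A $ i $ j) u)"
  note A = pos_def_matrix_inv[OF P]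
  have "student_Sigma \<theta> = ?A"
    by (simp add: student_Sigma_def \<theta>_def vec_eq_iff
        uprod_entry_Upair[OF symmetric_matrix_nth[OF pos_def_symmetric[OF A]]])
  moreover have "student_mu \<theta> = ?A *v \<eta>"
    by (simp add: student_mu_def \<theta>_def vec_eq_iff)
  ultimately show ?thesis
    using A P by (intro that[of \<theta>]) (simp_all add: student_Theta_def matrix_inv_matrix_inv)
qed

text \<open>The matrix \<open>t I + v v\<^sup>T\<close>, with quadratic form
  \<open>t * (x \<bullet> x) + (v \<bullet> x)\<^sup>2\<close>. It is positive definite for every v
  once t is positive, so v is an unrestricted test vector.\<close>

definition rank_one_update :: "real \<Rightarrow> real^'n \<Rightarrow> real^'n^'n" where
  "rank_one_update t v = (\<chi> i j. t * of_bool (i = j) + v $ i * v $ j)"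

lemma pos_def_rank_one_update:
  assumes "0 < t"
  shows "pos_def (rank_one_update t v)"
proof -
  have "transpose (rank_one_update t v) = rank_one_update t v"
    by (auto simp: rank_one_update_def transpose_def vec_eq_iff of_bool_def)
  moreover have "0 < x \<bullet> (rank_one_update t v *v x)" if "x \<noteq> 0" for x
  proof -
    have "rank_one_update t v *v x = t *\<^sub>R x + (v \<bullet> x) *\<^sub>R v"
    proof (subst vec_eq_iff, intro allI)
      fix i
      have "(rank_one_update t v *v x) $ i = (\<Sum>j\<in>UNIV. (if j = i then t * x $ j else 0) + v $ i * (v $ j * x $ j))"
        unfolding matrix_vector_mult_def vec_lambda_beta rank_one_update_def
        by (intro sum.cong) (auto simp: algebra_simps)
      also have "\<dots> = t * x $ i + v $ i * (v \<bullet> x)"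
        by (simp add: sum.distrib inner_vec_def sum_distrib_left)
      finally show "(rank_one_update t v *v x) $ i = (t *\<^sub>R x + (v \<bullet> x) *\<^sub>R v) $ i"
        by (simp add: mult.commute)
    qed
    then have "x \<bullet> (rank_one_update t v *v x) = t * (x \<bullet> x) + (v \<bullet> x)\<^sup>2"
      by (simp add: inner_add_right inner_commute power2_eq_square)
    then show ?thesis
      using assms that by (simp add: add_pos_nonneg)
  qed
  ultimately show ?thesis by (simp add: pos_def_def)
qed

lemma student_w_independent:
  fixes c :: "'d::finite + 'd uprod \<Rightarrow> real"
  assumes \<nu>: "0 < \<nu>"
    and zero: "\<And>\<theta> :: 'd student_param. \<theta> \<in> student_Theta \<Longrightarrow> c0 + (\<Sum>k\<in>UNIV. c k * student_w \<nu> k \<theta>) = 0"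
  shows "c0 = 0" "c k = 0"
proof -
  define a where "a = (\<chi> i. c (Inl i))"
  define B where "B = uprod_matrix (\<lambda>u. c (Inr u))"
  \<comment> \<open>The trace pairing with B, linear in P.\<close>
  define T where "T P = (\<Sum>i\<in>UNIV. \<Sum>j\<in>UNIV. B $ i $ j * P $ i $ j)" for P :: "real^'d^'d"
  \<comment> \<open>The given relation multiplied by
    \<open>\<nu> * student_offset \<nu> \<theta>\<close>, which clears every denominator, at the
    parameter belonging to \<open>\<eta>\<close> and P.\<close>
  have rel: "c0 * (\<nu> + \<eta> \<bullet> (matrix_inv P *v \<eta>)) - 2 * (a \<bullet> \<eta>) + T P = 0"
    if P: "pos_def P" for P and \<eta> :: "real^'d"
  proof -
    obtain \<theta> where \<theta>: "\<theta> \<in> student_Theta" and inv: "matrix_inv (student_Sigma \<theta>) = P"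
      and \<mu>: "student_mu \<theta> = matrix_inv P *v \<eta>"
      using student_param_exists[OF P] by metis
    let ?C = "student_offset \<nu> \<theta>"
    have C: "0 < ?C" by (rule student_offset_pos[OF \<nu> \<theta>])
    have P\<mu>: "P *v student_mu \<theta> = \<eta>"
      by (simp add: \<mu> matrix_vector_mul_assoc pos_def_mult_inverse[OF P])
    have offset: "\<nu> * ?C = \<nu> + \<eta> \<bullet> (matrix_inv P *v \<eta>)"
      using \<nu> by (simp add: student_offset_def inv P\<mu>) (simp add: \<mu> inner_commute field_simps)
    have "T P = (\<Sum>u\<in>UNIV. c (Inr u) * (\<nu> * ?C * student_w \<nu> (Inr u) \<theta>))"
      unfolding T_def B_def sum_uprod_matrix[OF pos_def_symmetric[OF P], symmetric]
      using \<nu> C by (simp add: student_w_def inv)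
    moreover have "- 2 * (a \<bullet> \<eta>) = (\<Sum>i\<in>UNIV. c (Inl i) * (\<nu> * ?C * student_w \<nu> (Inl i) \<theta>))"
      using \<nu> C by (simp add: student_w_def inv P\<mu> a_def inner_vec_def sum_distrib_left mult_ac)
    ultimately have "c0 * (\<nu> * ?C) - 2 * (a \<bullet> \<eta>) + T P
        = \<nu> * ?C * (c0 + (\<Sum>k\<in>UNIV. c k * student_w \<nu> k \<theta>))"
      by (simp add: sum_UNIV_Plus sum_distrib_left distrib_left mult_ac)
    then show ?thesis
      using zero[OF \<theta>] by (simp add: offset)
  qed
  have T_update: "T (rank_one_update t v) = t * (\<Sum>i\<in>UNIV. B $ i $ i) + v \<bullet> (B *v v)" for t v
  proof -
    have "T (rank_one_update t v)
        = (\<Sum>i\<in>UNIV. \<Sum>j\<in>UNIV. (if j = i then t * B $ i $ j else 0) + B $ i $ j * (v $ i * v $ j))"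
      unfolding T_def rank_one_update_def vec_lambda_beta
      by (intro sum.cong) (auto simp: algebra_simps)
    then show ?thesis
      by (simp add: sum.distrib sum_distrib_left quadratic_form_eq_sum)
  qed
  have upd: "c0 * \<nu> + t * (\<Sum>i\<in>UNIV. B $ i $ i) + v \<bullet> (B *v v) = 0" if "0 < t" for t v
    using rel[OF pos_def_rank_one_update[OF that], of 0 v] by (simp add: T_update)
  \<comment> \<open>At \<open>v = 0\<close> the relation is affine in t, so its vanishing at 1 and 2
    kills both the constant term and the slope.\<close>
  have "c0 * \<nu> = 0" and trace: "(\<Sum>i\<in>UNIV. B $ i $ i) = 0"
    using upd[of 1 0] upd[of 2 0] unfolding inner_zero_left by linarith+
  then show c0: "c0 = 0" using \<nu> by simp
  have "0 \<bullet> v + v \<bullet> (B *v v) = 0" for v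
    using upd[of 1 v] trace c0 by simp
  then have "B = 0"
    unfolding B_def by (intro quadratic_function_eq_zero(2)[of _ 0] transpose_uprod_matrix)
  \<comment> \<open>\<open>rank_one_update 1 0\<close> is the identity matrix; with c0 and B gone,
    only the linear term in \<open>\<eta>\<close> survives.\<close>
  have "a \<bullet> \<eta> = 0" for \<eta>
    using rel[OF pos_def_rank_one_update[of 1 0], of \<eta>] c0 \<open>B = 0\<close> by (simp add: T_def)
  then have "a = 0" by (metis inner_eq_zero_iff)
  have "c (Inl i) = 0" "c (Inr u) = 0" for i u
    using \<open>a = 0\<close> uprod_matrix_eq_zeroD[OF \<open>B = 0\<close>[unfolded B_def]] by (simp_all add: a_def vec_eq_iff)
  then show "c k = 0" by (cases k) simp_all
qed

section \<open>Range of alpha, normalizing factor and differentiability in the parameter\<close>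

lemma student_alpha_image:
  "student_alpha n ` {0<..} = {(real n - 2) / real n <..< 1}" if "0 < n"
proof
  have *: "(real n - 2) / real n = 1 - 2 / real n"
    using that by (simp add: field_simps)
  show "student_alpha n ` {0<..} \<subseteq> {(real n - 2) / real n <..< 1}"
    using that by (auto simp: * student_alpha_def intro!: divide_strict_left_mono add_pos_pos)
  show "{(real n - 2) / real n <..< 1} \<subseteq> student_alpha n ` {0<..}"
  proof
    fix a assume a: "a \<in> {(real n - 2) / real n <..< 1}"
    \<comment> \<open>The solution of \<open>a = 1 - 2 / (\<nu> + n)\<close>; it is positive because
      \<open>a > 1 - 2 / n\<close>.\<close>
    let ?\<nu> = "2 / (1 - a) - real n"
    have "0 < ?\<nu>" using a that by (simp add: field_simps)
    moreover have "a = student_alpha n ?\<nu>" using a by (simp add: student_alpha_def field_simps)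
    ultimately show "a \<in> student_alpha n ` {0<..}" by auto
  qed
qed

text \<open>The power of the offset is what \<open>student_base_eq\<close> factors out of the
  bracket.\<close>

definition student_Z :: "real \<Rightarrow> 'd::finite student_param \<Rightarrow> real" where
  "student_Z \<nu> \<theta> = student_norm TYPE('d) \<nu> / sqrt (det (student_Sigma \<theta>)) *
     student_offset \<nu> \<theta> powr (- ((\<nu> + real CARD('d)) / 2))"

lemma student_family_M_form:
  fixes \<theta> :: "'d::finite student_param"
  assumes \<nu>: "0 < \<nu>" and \<theta>: "\<theta> \<in> student_Theta"
  shows "0 < 1 + (\<Sum>k\<in>UNIV. student_w \<nu> k \<theta> * student_f k x)"
    and "student_family \<nu> \<theta> x = student_Z \<nu> \<theta> *
      (1 + (\<Sum>k\<in>UNIV. student_w \<nu> k \<theta> * student_f k x)) powr (1 / (student_alpha CARD('d) \<nu> - 1))"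
proof -
  let ?A = "student_Sigma \<theta>" and ?y = "x - student_mu \<theta>"
  have A: "pos_def ?A" using \<theta> by (simp add: student_Theta_def)
  have C: "0 < student_offset \<nu> \<theta>" by (rule student_offset_pos[OF assms])
  show pos: "0 < 1 + (\<Sum>k\<in>UNIV. student_w \<nu> k \<theta> * student_f k x)"
    using student_base_pos[OF \<nu> A, of ?y] C unfolding student_base_eq[OF assms]
    by (simp add: zero_less_mult_iff)
  then show "student_family \<nu> \<theta> x = student_Z \<nu> \<theta> *
      (1 + (\<Sum>k\<in>UNIV. student_w \<nu> k \<theta> * student_f k x)) powr (1 / (student_alpha CARD('d) \<nu> - 1))"
    using C unfolding student_family_def student_density_eq[OF \<nu>] student_base_eq[OF assms]
      student_exponent[OF \<nu>]
    by (simp add: powr_mult student_Z_def)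
qed

lemma differentiable_student_param:
  fixes \<theta> :: "'d::finite student_param"
  assumes \<nu>: "0 < \<nu>" and \<theta>: "\<theta> \<in> student_Theta"
  shows "student_w \<nu> k differentiable (at \<theta> within student_Theta)"
    and "student_Z \<nu> differentiable (at \<theta> within student_Theta)"
proof -
  let ?D = "\<lambda>f :: 'd student_param \<Rightarrow> real. f differentiable (at \<theta> within student_Theta)"
  have \<mu>: "?D (\<lambda>\<theta>. student_mu \<theta> $ i)" for i
    by (simp add: student_mu_def differentiable_vec_nth)
  have \<Sigma>: "?D (\<lambda>\<theta>. student_Sigma \<theta> $ i $ j)" for i j
    by (simp add: student_Sigma_def differentiable_vec_nth)
  have det: "0 < det (student_Sigma \<theta>)" if "\<theta> \<in> student_Theta" for \<theta> :: "'d student_param"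
    using that by (intro det_pos_def) (simp add: student_Theta_def)
  have P: "?D (\<lambda>\<theta>. matrix_inv (student_Sigma \<theta>) $ i $ j)" for i j
    using \<Sigma> \<theta> by (intro differentiable_matrix_inv) (auto dest: det)
  have P\<mu>: "?D (\<lambda>\<theta>. (matrix_inv (student_Sigma \<theta>) *v student_mu \<theta>) $ i)" for i
    unfolding matrix_vector_mult_def vec_lambda_beta
    by (intro differentiable_sum ballI differentiable_mult P \<mu>) simp
  have C: "0 < student_offset \<nu> \<theta>" by (rule student_offset_pos[OF assms])
  have D_offset: "?D (\<lambda>\<theta>. student_offset \<nu> \<theta>)"
    unfolding student_offset_def inner_vec_def inner_real_def
    by (intro differentiable_add differentiable_const differentiable_sum ballI differentiable_mult P\<mu> \<mu>) simp
  show "?D (student_w \<nu> k)"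
  proof (cases k)
    case (Inl i)
    show ?thesis
      unfolding student_w_def[abs_def] Inl sum.case using \<nu> C
      by (intro differentiable_divide differentiable_mult differentiable_const P\<mu> D_offset) simp
  next
    case (Inr u)
    show ?thesis
      unfolding student_w_def[abs_def] Inr sum.case uprod_entry_def case_prod_beta using \<nu> C
      by (intro differentiable_divide differentiable_mult differentiable_const P D_offset) simp
  qed
  \<comment> \<open>The square root is written as the power 1/2 so that
    \<open>differentiable_powr\<close> applies; the two agree on the parameter set, where the
    determinant is positive.\<close>
  have "?D (\<lambda>\<theta>. student_norm TYPE('d) \<nu> / (det (student_Sigma \<theta>) powr (1 / 2)) *
      student_offset \<nu> \<theta> powr (- ((\<nu> + real CARD('d)) / 2)))"
    using det[OF \<theta>] C \<theta>
    by (intro differentiable_mult differentiable_divide differentiable_const differentiable_powr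
        differentiable_det \<Sigma> D_offset) simp_all
  then show "?D (student_Z \<nu>)"
    by (rule differentiable_transform_within[where d = 1])
      (use \<theta> det in \<open>auto simp: student_Z_def powr_half_sqrt less_imp_le\<close>)
qed

section \<open>Assembly of the family with index range 1 to s\<close>

theorem corollary5:
  fixes \<nu> :: real
  assumes "0 < \<nu>"
  shows "student_alpha CARD('d::finite) ` {0<..}
           = {(real CARD('d) - 2) / real CARD('d) <..< 1} \<and>
         (\<exists>s h w f S. regular_M_family (student_alpha CARD('d) \<nu>) s h w f
           (student_Theta :: 'd student_param set) S (student_family \<nu>))"
proof
  let ?K = "UNIV :: ('d + 'd uprod) set" and ?s = "CARD('d + 'd uprod)"
    and ?\<alpha> = "student_alpha CARD('d) \<nu>"
  show "student_alpha CARD('d) ` {0<..} = {(real CARD('d) - 2) / real CARD('d) <..< 1}"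
    by (rule student_alpha_image) simp
  obtain e where e: "bij_betw e {1..?s} ?K"
    using ex_bij_betw_nat_finite_1[of ?K] by auto
  have reindex: "(\<Sum>i=1..?s. g (e i)) = (\<Sum>k\<in>?K. g k)" for g :: "'d + 'd uprod \<Rightarrow> real"
    by (rule sum.reindex_bij_betw[OF e])
  \<comment> \<open>The inverse enumeration carries a coefficient sequence on \<open>{1..?s}\<close>
    to the index type of the statistics.\<close>
  define e' where "e' = the_inv_into {1..?s} e"
  have e': "e' (e i) = i" if "i \<in> {1..?s}" for i
    using e that by (simp add: e'_def bij_betw_def the_inv_into_f_f)
  have transfer: "(\<Sum>i=1..?s. c i * g (e i)) = (\<Sum>k\<in>?K. c (e' k) * g k)"
    for c :: "nat \<Rightarrow> real" and g
  proof -
    have "(\<Sum>i=1..?s. c i * g (e i)) = (\<Sum>i=1..?s. c (e' (e i)) * g (e i))"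
      by (intro sum.cong) (simp_all add: e')
    also have "\<dots> = (\<Sum>k\<in>?K. c (e' k) * g k)" by (rule reindex)
    finally show ?thesis .
  qed
  define w where "w i = student_w \<nu> (e i)" for i
  define f where "f i = (student_f (e i) :: real^'d \<Rightarrow> real)" for i
  \<comment> \<open>The Student density is positive everywhere, so the support is the whole
    space.\<close>
  define S where "S = (\<lambda>\<theta> :: 'd student_param. UNIV :: (real^'d) set)"
  have base: "(\<Sum>i=1..?s. w i \<theta> * f i x) = (\<Sum>k\<in>?K. student_w \<nu> k \<theta> * student_f k x)" for \<theta> x
    unfolding w_def f_def by (rule reindex)
  have pd: "pos_def (student_Sigma \<theta>)" if "\<theta> \<in> student_Theta" for \<theta> :: "'d student_param"
    using that by (simp add: student_Theta_def)
  have "M_family ?\<alpha> ?s (\<lambda>_. 1) w f student_Theta S (student_family \<nu>)"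
    unfolding M_family_def
  proof (intro conjI ballI exI[of _ "student_Z \<nu>"] allI impI)
    have "0 < \<nu> + real CARD('d)" using assms by simp
    then show "?\<alpha> \<noteq> 1" by (simp add: student_alpha_def)
    show "open (student_Theta :: 'd student_param set)"
      by (rule open_student_Theta)
    show "student_Z \<nu> differentiable_on (student_Theta :: 'd student_param set)"
      "w i differentiable_on (student_Theta :: 'd student_param set)" for i
      using differentiable_student_param[OF assms] by (auto simp: differentiable_on_def w_def)
  next
    fix \<theta> :: "'d student_param" assume \<theta>: "\<theta> \<in> student_Theta"
    show "prob_density (student_family \<nu> \<theta>)"
      unfolding student_family_def by (rule prob_density_student[OF assms pd[OF \<theta>]])
    show "S \<theta> = {x. student_family \<nu> \<theta> x > 0}"
      using student_density_pos[OF assms pd[OF \<theta>]] by (simp add: S_def student_family_def)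
    show "1 + (\<Sum>i=1..?s. w i \<theta> * f i x) > 0"
      and "student_family \<nu> \<theta> x
        = student_Z \<nu> \<theta> * (1 + (\<Sum>i=1..?s. w i \<theta> * f i x)) powr (1 / (?\<alpha> - 1))" for x
      unfolding base by (fact student_family_M_form[OF assms \<theta>])+
    show "student_family \<nu> \<theta> x = 0" if "x \<notin> S \<theta>" for x
      using that by (simp add: S_def)
  qed
  moreover have "lin_indep_funs_on student_Theta {0..?s} (\<lambda>i. if i = 0 then (\<lambda>_. 1) else w i)"
    unfolding lin_indep_funs_on_def
  proof (intro allI impI)
    fix c :: "nat \<Rightarrow> real"
    assume *: "\<forall>\<theta>\<in>student_Theta. (\<Sum>i\<in>{0..?s}. c i * (if i = 0 then (\<lambda>_. 1) else w i) \<theta>) = 0"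
    have rel: "c 0 + (\<Sum>k\<in>?K. c (e' k) * student_w \<nu> k \<theta>) = 0" if "\<theta> \<in> student_Theta" for \<theta>
    proof -
      have "(\<Sum>i=1..?s. c i * (if i = 0 then (\<lambda>_. 1) else w i) \<theta>) = (\<Sum>i=1..?s. c i * w i \<theta>)"
        by (intro sum.cong) auto
      also have "\<dots> = (\<Sum>k\<in>?K. c (e' k) * student_w \<nu> k \<theta>)"
        unfolding w_def by (rule transfer)
      finally show ?thesis
        using *[rule_format, OF that] by (simp add: sum.atLeast_Suc_atMost)
    qed
    note zero = student_w_independent[OF assms rel]
    show "\<forall>i\<in>{0..?s}. c i = 0"
    proof
      fix i assume "i \<in> {0..?s}"
      \<comment> \<open>Index 0 belongs to the constant function 1, the others to the coefficients
        w.\<close>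
      then consider "i = 0" | "i \<in> {1..?s}" by fastforce
      then show "c i = 0"
        using zero(1) zero(2)[of "e i"] e' by cases auto
    qed
  qed
  moreover have "lin_indep_funs_on (S \<theta>) {1..?s} f" for \<theta>
    unfolding lin_indep_funs_on_def
  proof (intro allI impI ballI)
    fix c :: "nat \<Rightarrow> real" and i
    assume *: "\<forall>x\<in>S \<theta>. (\<Sum>i=1..?s. c i * f i x) = 0" and i: "i \<in> {1..?s}"
    have "(\<Sum>k\<in>?K. c (e' k) * student_f k x) = 0" for x
      using * transfer[of c "\<lambda>k. student_f k x"] by (simp add: S_def f_def)
    from student_f_independent[OF this, of "e i"] show "c i = 0"
      using i by (simp add: e')
  qed
  ultimately have "regular_M_family ?\<alpha> ?s (\<lambda>_. 1) w f student_Theta S (student_family \<nu>)"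
    by (simp add: regular_M_family_def S_def)
  then show "\<exists>s h w f S. regular_M_family ?\<alpha> s h w f
      (student_Theta :: 'd student_param set) S (student_family \<nu>)"
    by blast
qed

end
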